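(* Let $n,k$ be powers of $2$ with $1\le k\le n$, and let $\bar x\in\mathbb N^n$. Run the comparator network $bit\_sel^n_k$ on $\bar x$: (1) let $l=n/k$; partition $\bar x$ into $l$ consecutive blocks of size $k$ and sort each block with $oe\_sort^k$, obtaining $B_1,\dots,B_l$; (2) while $l>1$: group the blocks into pairs $\langle B_1,B_2\rangle,\dots,\langle B_{l-1},B_l\rangle$; for each $i\in\{1,3,\dots,l-1\}$ compute $\bar y_i=bit\_split^{2k}(B_i::B_{i+1})$ and $B'_{\lceil i/2\rceil}=bit\_merge^k(left(\bar y_i))$ (the sequences $right(\bar y_i)$ are discarded); set $l=l/2$ and rename $B'_i$ to $B_i$ for $1\le i\le l$. Then $bit\_sel^n_k$ is a selection network: the final block $B_1$ is sorted and coincides with the first $k$ entries of the nonincreasing rearrangement of $\bar x$ (it contains the $k$ largest elements of $\bar x$).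
   Context: A sequence is sorted if it is nonincreasing. $\bar x::\bar y$ denotes concatenation; $left$, $right$ denote first and second halves of an even-length sequence. A comparator $c_{i,j}$ ($i<j$) puts the maximum of the entries at positions $i,j$ into position $i$ and the minimum into position $j$. $oe\_sort^k$ is Batcher's odd-even sorting network on $k$ inputs (its output is sorted for every input). For $m$ even, $split^m$ applies $c_{i,m/2+i}$ for $i=1,\dots,m/2$ and $bit\_split^m$ applies $c_{i,m-i+1}$ for $i=1,\dots,m/2$. For $m$ a power of $2$, Batcher's bitonic merger $bit\_merge^m$ is: no comparators if $m=1$; the comparator $c_{1,2}$ if $m=2$; otherwise $split^m$ followed by $bit\_merge^{m/2}$ on each half. *)

theory Defs
  imports Main
begin

text \<open>
  Sequences are lists, with positions counted from \<open>0\<close>; sorted means nonincreasing.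
  A comparator network is a list of comparators \<open>(i, j)\<close> with \<open>i < j\<close>, applied from left to right.
\<close>

type_synonym network = "(nat \<times> nat) list"

definition apply_comparator :: "nat \<times> nat \<Rightarrow> 'a::linorder list \<Rightarrow> 'a list" where
  "apply_comparator c xs =
     (case c of (i, j) \<Rightarrow> xs[i := max (xs ! i) (xs ! j), j := min (xs ! i) (xs ! j)])"

definition run :: "network \<Rightarrow> 'a::linorder list \<Rightarrow> 'a list" where
  "run net xs = fold apply_comparator net xs"

text \<open>The copy of a network in which wire \<open>i\<close> of the network is placed on wire \<open>f i\<close>.\<close>

definition relocate :: "(nat \<Rightarrow> nat) \<Rightarrow> network \<Rightarrow> network" where
  "relocate f net = map (map_prod f f) net"

text \<open>
  Batcher's odd-even merger on \<open>m\<close> wires (\<open>m\<close> a power of \<open>2\<close>), for two sorted halves.  The wires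
  \<open>0, 2, 4, \<dots>\<close> carry the odd-numbered entries (first, third, ...) of both halves, the
  wires \<open>1, 3, 5, \<dots>\<close> the even-numbered ones.  Both are merged recursively in place; the final
  comparators act on the wires \<open>(1, 2), (3, 4), \<dots>, (m - 3, m - 2)\<close>.
\<close>

fun oe_merge :: "nat \<Rightarrow> network" where
  "oe_merge m =
     (if m \<le> 1 then []
      else if m = 2 then [(0, 1)]
      else relocate (\<lambda>i. 2 * i) (oe_merge (m div 2))
         @ relocate (\<lambda>i. 2 * i + 1) (oe_merge (m div 2))
         @ map (\<lambda>i. (2 * i + 1, 2 * i + 2)) [0..<m div 2 - 1])"

declare oe_merge.simps [simp del]

fun oe_sort :: "nat \<Rightarrow> network" where
  "oe_sort m =
     (if m \<le> 1 then []
      else oe_sort (m div 2)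
         @ relocate (\<lambda>i. m div 2 + i) (oe_sort (m div 2))
         @ oe_merge m)"

declare oe_sort.simps [simp del]

definition split :: "nat \<Rightarrow> network" where
  "split m = map (\<lambda>i. (i, m div 2 + i)) [0..<m div 2]"

definition bit_split :: "nat \<Rightarrow> network" where
  "bit_split m = map (\<lambda>i. (i, m - 1 - i)) [0..<m div 2]"

fun bit_merge :: "nat \<Rightarrow> network" where
  "bit_merge m =
     (if m \<le> 1 then []
      else if m = 2 then [(0, 1)]
      else split m
         @ bit_merge (m div 2)
         @ relocate (\<lambda>i. m div 2 + i) (bit_merge (m div 2)))"

declare bit_merge.simps [simp del]

definition left :: "'a list \<Rightarrow> 'a list" where
  "left xs = take (length xs div 2) xs"

definition blocks :: "nat \<Rightarrow> nat \<Rightarrow> 'a list \<Rightarrow> 'a list list" where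
  "blocks l k xs = map (\<lambda>i. take k (drop (i * k) xs)) [0..<l]"

text \<open>One iteration of the loop; the block \<open>B\<^sub>i\<close> is the list element \<open>Bs ! (i - 1)\<close>.\<close>

definition bit_sel_round :: "nat \<Rightarrow> 'a::linorder list list \<Rightarrow> 'a list list" where
  "bit_sel_round k Bs =
     map (\<lambda>i. run (bit_merge k) (left (run (bit_split (2 * k)) (Bs ! (2 * i) @ Bs ! (2 * i + 1)))))
       [0..<length Bs div 2]"

function bit_sel_loop :: "nat \<Rightarrow> 'a::linorder list list \<Rightarrow> 'a list list" where
  "bit_sel_loop k Bs =
     (if length Bs > 1 then bit_sel_loop k (bit_sel_round k Bs) else Bs)"
  by auto
termination
  by (relation "measure (\<lambda>(k, Bs). length Bs)") (auto simp: bit_sel_round_def)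

declare bit_sel_loop.simps [simp del]

text \<open>The block \<open>B\<^sub>1\<close> at the end of the loop.\<close>

definition bit_sel :: "nat \<Rightarrow> nat \<Rightarrow> 'a::linorder list \<Rightarrow> 'a list" where
  "bit_sel n k xs = hd (bit_sel_loop k (map (run (oe_sort k)) (blocks (n div k) k xs)))"

end

theory Submission
  imports Defs "HOL-Library.Multiset"
begin

text \<open>
  By the zero-one principle, every step of the algorithm commutes with monotone maps, in particular
  with the thresholds \<open>\<lambda>x. t \<le> x\<close>, so it suffices to treat Boolean inputs.  There a sorted
  sequence is determined by its number of ones, and everything becomes arithmetic: two sorted
  blocks with \<open>p\<close> and \<open>q\<close> ones are combined by a round into a sorted block with
  \<open>min k (p + q)\<close> ones, and truncating at \<open>k\<close> early does not affect the sum truncated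
  at \<open>k\<close>.
\<close>

section \<open>Networks on a given number of wires\<close>

text \<open>Outside the list, \<open>!\<close> returns an unspecified value and an update has no
  effect. This bound excludes both, so that \<open>run\<close> commutes with maps and stays local to
  a prefix.\<close>

definition wires :: "network \<Rightarrow> nat \<Rightarrow> bool" where
  "wires net m \<longleftrightarrow> (\<forall>(i, j) \<in> set net. i < m \<and> j < m)"

lemma wires_Nil [simp]: "wires [] m"
  and wires_Cons [simp]: "wires (c # net) m \<longleftrightarrow> fst c < m \<and> snd c < m \<and> wires net m"
  and wires_append [simp]: "wires (net @ net') m \<longleftrightarrow> wires net m \<and> wires net' m"
  by (auto simp: wires_def)

lemma wires_mono: "wires net m \<Longrightarrow> m \<le> m' \<Longrightarrow> wires net m'"
  by (fastforce simp: wires_def)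

lemma wires_relocate: "wires net m \<Longrightarrow> (\<And>i. i < m \<Longrightarrow> f i < m') \<Longrightarrow> wires (relocate f net) m'"
  by (fastforce simp: wires_def relocate_def)

lemma run_Nil [simp]: "run [] xs = xs"
  and run_Cons: "run (c # net) xs = run net (apply_comparator c xs)"
  and run_append: "run (net @ net') xs = run net' (run net xs)"
  by (simp_all add: run_def)

lemma length_apply_comparator [simp]: "length (apply_comparator c xs) = length xs"
  by (simp add: apply_comparator_def split: prod.split)

lemma length_run [simp]: "length (run net xs) = length xs"
  by (induction net arbitrary: xs) (simp_all add: run_Cons)

text \<open>The core of the zero-one principle: a monotone map between linear orders commutes with
  \<open>max\<close> and \<open>min\<close>, hence with each comparator.\<close>

lemma run_map:
  assumes "mono f" and "wires net (length xs)"
  shows "run net (map f xs) = map f (run net xs)"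
  using assms(2)
proof (induction net arbitrary: xs)
  case (Cons c net)
  have "apply_comparator c (map f xs) = map f (apply_comparator c xs)"
    using Cons.prems
    by (auto simp: apply_comparator_def map_update max_of_mono[OF assms(1)] min_of_mono[OF assms(1)]
        split: prod.split)
  with Cons show ?case by (simp add: run_Cons)
qed simp

lemma run_append_left: "wires net (length xs) \<Longrightarrow> run net (xs @ ys) = run net xs @ ys"
proof (induction net arbitrary: xs)
  case (Cons c net)
  have "apply_comparator c (xs @ ys) = apply_comparator c xs @ ys"
    using Cons.prems by (auto simp: apply_comparator_def nth_append list_update_append split: prod.split)
  with Cons show ?case by (simp add: run_Cons)
qed simp

lemma run_append_right: "run (relocate (\<lambda>i. length xs + i) net) (xs @ ys) = xs @ run net ys"
proof (induction net arbitrary: ys)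
  case (Cons c net)
  have "apply_comparator (map_prod ((+) (length xs)) ((+) (length xs)) c) (xs @ ys)
      = xs @ apply_comparator c ys"
    by (auto simp: apply_comparator_def nth_append list_update_append split: prod.split)
  with Cons show ?case by (simp add: run_Cons relocate_def)
qed (simp add: relocate_def)

text \<open>For networks embedded on scattered wires, such as the interleaved recursive calls of
  \<open>oe_merge\<close>. Injectivity of \<open>f\<close> makes an update of wire
  \<open>f i\<close> visible only as an update of position \<open>i\<close> in the extracted
  subsequence.\<close>

lemma run_relocate:
  assumes "inj f" and "wires net m" and "\<And>i. i < m \<Longrightarrow> f i < length xs"
  shows "map (\<lambda>i. run (relocate f net) xs ! f i) [0..<m] = run net (map (\<lambda>i. xs ! f i) [0..<m])"
    and "j \<notin> range f \<Longrightarrow> run (relocate f net) xs ! j = xs ! j"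
proof -
  show "map (\<lambda>i. run (relocate f net) xs ! f i) [0..<m] = run net (map (\<lambda>i. xs ! f i) [0..<m])"
    using assms(2,3)
  proof (induction net arbitrary: xs)
    case (Cons c net)
    let ?ys = "apply_comparator (map_prod f f c) xs"
    have "map (\<lambda>i. ?ys ! f i) [0..<m] = apply_comparator c (map (\<lambda>i. xs ! f i) [0..<m])"
      using Cons.prems
      by (intro nth_equalityI)
        (auto simp: apply_comparator_def nth_list_update inj_eq[OF assms(1)] split: prod.splits)
    with Cons show ?case by (simp add: run_Cons relocate_def)
  qed (simp add: relocate_def)
  show "run (relocate f net) xs ! j = xs ! j" if "j \<notin> range f"
  proof (induction net arbitrary: xs)
    case (Cons c net)
    have "f i \<noteq> j" for i using that by auto
    then have "apply_comparator (map_prod f f c) xs ! j = xs ! j"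
      by (cases c) (simp add: apply_comparator_def)
    with Cons show ?case by (simp add: run_Cons relocate_def)
  qed (simp add: relocate_def)
qed

text \<open>The pairs of wires are pairwise disjoint, so every comparator still sees the original
  input values.\<close>

lemma run_parallel:
  assumes "inj_on f {..<h}" and "inj_on g {..<h}"
    and "\<And>i j. i < h \<Longrightarrow> j < h \<Longrightarrow> f i \<noteq> g j"
    and "\<And>i. i < h \<Longrightarrow> f i < length xs \<and> g i < length xs"
  defines "ys \<equiv> run (map (\<lambda>i. (f i, g i)) [0..<h]) xs"
  shows "i < h \<Longrightarrow> ys ! f i = max (xs ! f i) (xs ! g i)"
    and "i < h \<Longrightarrow> ys ! g i = min (xs ! f i) (xs ! g i)"
    and "j \<notin> f ` {..<h} \<Longrightarrow> j \<notin> g ` {..<h} \<Longrightarrow> ys ! j = xs ! j"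
proof -
  \<comment> \<open>The claims are proved together: the statement about untouched wires supplies the
    original inputs of the next comparator.\<close>
  have *: "(\<forall>i<n. run (map (\<lambda>i. (f i, g i)) [0..<n]) xs ! f i = max (xs ! f i) (xs ! g i)
          \<and> run (map (\<lambda>i. (f i, g i)) [0..<n]) xs ! g i = min (xs ! f i) (xs ! g i))
      \<and> (\<forall>j. j \<notin> f ` {..<n} \<longrightarrow> j \<notin> g ` {..<n} \<longrightarrow>
          run (map (\<lambda>i. (f i, g i)) [0..<n]) xs ! j = xs ! j)"
    if "n \<le> h" for n
    using that
  proof (induction n)
    case (Suc n)
    let ?zs = "run (map (\<lambda>i. (f i, g i)) [0..<n]) xs"
    have run: "run (map (\<lambda>i. (f i, g i)) [0..<Suc n]) xs = apply_comparator (f n, g n) ?zs"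
      by (simp add: run_append run_Cons)
    have fresh: "f n \<notin> f ` {..<n}" "f n \<notin> g ` {..<n}" "g n \<notin> f ` {..<n}" "g n \<notin> g ` {..<n}"
      using Suc.prems by (auto simp: inj_on_eq_iff[OF assms(1)] inj_on_eq_iff[OF assms(2)]
          assms(3) assms(3)[symmetric])
    then have zs: "?zs ! f n = xs ! f n" "?zs ! g n = xs ! g n"
      using Suc by auto
    have bounds: "f n < length xs" "g n < length xs" "f n \<noteq> g n"
      using Suc.prems assms(3,4) by auto
    show ?case
      unfolding run using Suc fresh bounds
      by (auto simp: apply_comparator_def zs nth_list_update less_Suc_eq lessThan_Suc)
  qed simp
  show "i < h \<Longrightarrow> ys ! f i = max (xs ! f i) (xs ! g i)"
    and "i < h \<Longrightarrow> ys ! g i = min (xs ! f i) (xs ! g i)"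
    and "j \<notin> f ` {..<h} \<Longrightarrow> j \<notin> g ` {..<h} \<Longrightarrow> ys ! j = xs ! j"
    using *[OF order_refl] by (auto simp: ys_def)
qed

section \<open>The effect of the two splitting steps\<close>

lemma run_split:
  assumes "length xs = h" and "length ys = h"
  shows "run (split (2 * h)) (xs @ ys) = map2 max xs ys @ map2 min xs ys"
proof -
  note par = run_parallel[where f = "\<lambda>i. i" and g = "\<lambda>i. h + i" and h = h and xs = "xs @ ys"]
  show ?thesis
  proof (rule nth_equalityI)
    fix i assume "i < length (run (split (2 * h)) (xs @ ys))"
    then have "i < 2 * h" using assms by simp
    show "run (split (2 * h)) (xs @ ys) ! i = (map2 max xs ys @ map2 min xs ys) ! i"
    proof (cases "i < h")
      case True
      then show ?thesis using assms par(1)[of i] by (simp add: split_def nth_append)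
    next
      case False
      then show ?thesis using assms par(2)[of "i - h"] \<open>i < 2 * h\<close> by (simp add: split_def nth_append)
    qed
  qed (use assms in simp)
qed

text \<open>Wire \<open>2 * k - 1 - i\<close> carries entry \<open>k - 1 - i\<close> of
  \<open>ys\<close>, which is entry \<open>i\<close> of \<open>rev ys\<close>. The right half is
  discarded by the algorithm and needs no description.\<close>

lemma left_run_bit_split:
  assumes "length xs = k" and "length ys = k"
  shows "left (run (bit_split (2 * k)) (xs @ ys)) = map2 max xs (rev ys)"
proof (rule nth_equalityI)
  note par = run_parallel(1)[where f = "\<lambda>i. i" and g = "\<lambda>i. 2 * k - 1 - i" and h = k and xs = "xs @ ys"]
  fix i assume "i < length (left (run (bit_split (2 * k)) (xs @ ys)))"
  then have i: "i < k" using assms by (simp add: left_def)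
  have "run (map (\<lambda>i. (i, 2 * k - 1 - i)) [0..<k]) (xs @ ys) ! i
      = max ((xs @ ys) ! i) ((xs @ ys) ! (2 * k - 1 - i))"
    by (rule par) (use i assms in \<open>auto simp: inj_on_def\<close>)
  then have "run (bit_split (2 * k)) (xs @ ys) ! i = max (xs ! i) (ys ! (k - 1 - i))"
    using i assms by (simp add: bit_split_def nth_append)
  then show "left (run (bit_split (2 * k)) (xs @ ys)) ! i = map2 max xs (rev ys) ! i"
    using i assms by (simp add: left_def rev_nth)
qed (use assms in \<open>simp add: left_def\<close>)

section \<open>The odd-even sorter on Boolean inputs\<close>

lemma max_bool: "max = (\<or>)" and min_bool: "min = (\<and>)"
  by (auto simp: fun_eq_iff max_def min_def)

text \<open>These are exactly the nonincreasing Boolean sequences of length \<open>m\<close>, so a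
  sorted block is encoded by its number of ones. Any \<open>p\<close> above \<open>m\<close> acts
  like \<open>p = m\<close>.\<close>

definition unary :: "nat \<Rightarrow> nat \<Rightarrow> bool list" where
  "unary p m = map (\<lambda>i. i < p) [0..<m]"

abbreviation ones :: "bool list \<Rightarrow> nat" where
  "ones xs \<equiv> count_list xs True"

lemma length_unary [simp]: "length (unary p m) = m"
  and nth_unary [simp]: "i < m \<Longrightarrow> unary p m ! i \<longleftrightarrow> i < p"
  by (simp_all add: unary_def)

lemma eq_unary_iff: "xs = unary p m \<longleftrightarrow> length xs = m \<and> (\<forall>i<m. xs ! i \<longleftrightarrow> i < p)"
  by (auto simp: list_eq_iff_nth_eq)

lemma ones_unary [simp]: "ones (unary p m) = min p m"
  by (induction m) (auto simp: unary_def)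

text \<open>Nothing is out of order at the seam when the left block is all ones or the right block
  is all zeros. This is the situation after a bitonic split.\<close>

lemma unary_append: "p = m \<or> q = 0 \<Longrightarrow> p \<le> m \<Longrightarrow> unary p m @ unary q n = unary (p + q) (m + n)"
  unfolding eq_unary_iff by (auto simp: nth_append)

section \<open>Correctness of the odd-even merger and sorter\<close>

lemma oe_merge_1 [simp]: "oe_merge (Suc 0) = []"
  and oe_merge_2: "oe_merge 2 = [(0, 1)]"
  by (simp_all add: oe_merge.simps)

lemma oe_merge_double:
  "1 < h \<Longrightarrow> oe_merge (2 * h) = relocate (\<lambda>i. 2 * i) (oe_merge h)
     @ relocate (\<lambda>i. 2 * i + 1) (oe_merge h) @ map (\<lambda>i. (2 * i + 1, 2 * i + 2)) [0..<h - 1]"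
  by (subst oe_merge.simps) simp

lemma oe_sort_1 [simp]: "oe_sort (Suc 0) = []"
  and oe_sort_double: "0 < h \<Longrightarrow>
    oe_sort (2 * h) = oe_sort h @ relocate (\<lambda>i. h + i) (oe_sort h) @ oe_merge (2 * h)"
  by (simp add: oe_sort.simps, subst oe_sort.simps, simp)

lemma wires_oe_merge: "wires (oe_merge (2 ^ a)) (2 ^ a)"
proof (induction a)
  case (Suc a)
  show ?case
  proof (cases "a = 0")
    case False
    then have "1 < (2::nat) ^ a" by (intro one_less_power) simp_all
    from oe_merge_double[OF this] Suc.IH show ?thesis
      by (auto simp: wires_def relocate_def map_prod_def split_beta)
  qed (simp add: oe_merge_2)
qed simp

lemma wires_oe_sort: "wires (oe_sort (2 ^ a)) (2 ^ a)"
proof (induction a)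
  case (Suc a)
  with wires_oe_merge[of "Suc a"] show ?case
    by (auto simp: oe_sort_double intro: wires_mono wires_relocate)
qed simp

text \<open>After the recursive merges the even wires carry \<open>E\<close> ones and the odd wires
  \<open>D\<close>, each group sorted, with \<open>D \<le> E \<le> D + 2\<close>. The interleaving
  is already sorted unless \<open>E = D + 2\<close>; then a zero on wire \<open>2 * D + 1\<close>
  precedes a one on wire \<open>2 * D + 2\<close>, and the final comparators exchange just these
  two.\<close>

lemma run_oe_merge:
  "p \<le> 2 ^ a \<Longrightarrow> q \<le> 2 ^ a \<Longrightarrow>
    run (oe_merge (2 ^ Suc a)) (unary p (2 ^ a) @ unary q (2 ^ a)) = unary (p + q) (2 ^ Suc a)"
proof (induction a arbitrary: p q)
  case 0
  then have "p = 0 \<or> p = 1" "q = 0 \<or> q = 1" by auto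
  then show ?case
    by (auto simp: oe_merge_2 run_Cons apply_comparator_def unary_def upt_rec)
next
  case (Suc a)
  define h :: nat where "h = 2 ^ Suc a"
  define xs where "xs = unary p h @ unary q h"
  \<comment> \<open>Counting wires from \<open>0\<close>, a sorted half with \<open>p\<close> ones
    has \<open>p / 2\<close> ones rounded up on its even wires and rounded down on its odd
    wires.\<close>
  define E where "E = (p + 1) div 2 + (q + 1) div 2"
  define D where "D = p div 2 + q div 2"
  have "1 < h" unfolding h_def by (rule one_less_power) simp_all
  have "even h" by (simp add: h_def)
  have pq: "p \<le> h" "q \<le> h" using Suc.prems by (simp_all add: h_def)
  have wires: "wires (oe_merge h) h" unfolding h_def by (rule wires_oe_merge)
  have [simp]: "length xs = 2 * h" by (simp add: xs_def)
  \<comment> \<open>As \<open>h\<close> is even, the second half starts on an even wire, so each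
    half contributes \<open>2 ^ a\<close> wires of either parity.\<close>
  have evens: "map (\<lambda>i. xs ! (2 * i)) [0..<h] = unary ((p + 1) div 2) (2 ^ a) @ unary ((q + 1) div 2) (2 ^ a)"
    by (rule nth_equalityI) (auto simp: xs_def nth_append h_def)
  have odds: "map (\<lambda>i. xs ! (2 * i + 1)) [0..<h] = unary (p div 2) (2 ^ a) @ unary (q div 2) (2 ^ a)"
    by (rule nth_equalityI) (auto simp: xs_def nth_append h_def)
  define ys where "ys = run (relocate (\<lambda>i. 2 * i) (oe_merge h)) xs"
  define zs where "zs = run (relocate (\<lambda>i. 2 * i + 1) (oe_merge h)) ys"
  have [simp]: "length ys = 2 * h" "length zs = 2 * h" by (simp_all add: ys_def zs_def)
  have "map (\<lambda>i. ys ! (2 * i)) [0..<h] = run (oe_merge h) (map (\<lambda>i. xs ! (2 * i)) [0..<h])"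
    unfolding ys_def by (rule run_relocate(1)[OF _ wires]) (auto simp: inj_def)
  also have "\<dots> = unary E h"
    unfolding evens E_def unfolding h_def using Suc.prems by (intro Suc.IH) simp_all
  finally have ys_even: "map (\<lambda>i. ys ! (2 * i)) [0..<h] = unary E h" .
  have ys_odd: "ys ! (2 * i + 1) = xs ! (2 * i + 1)" for i
    unfolding ys_def by (rule run_relocate(2)[OF _ wires]) (auto simp: inj_def, presburger)
  have "map (\<lambda>i. zs ! (2 * i + 1)) [0..<h] = run (oe_merge h) (map (\<lambda>i. ys ! (2 * i + 1)) [0..<h])"
    unfolding zs_def by (rule run_relocate(1)[OF _ wires]) (auto simp: inj_def)
  also have "\<dots> = unary D h"
    unfolding ys_odd odds D_def unfolding h_def using Suc.prems by (intro Suc.IH) simp_all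
  finally have zs_odd: "zs ! (2 * i + 1) \<longleftrightarrow> i < D" if "i < h" for i
    using that by (simp add: eq_unary_iff)
  have "zs ! (2 * i) = ys ! (2 * i)" for i
    unfolding zs_def by (rule run_relocate(2)[OF _ wires]) (auto simp: inj_def, presburger)
  with ys_even have zs_even: "zs ! (2 * i) \<longleftrightarrow> i < E" if "i < h" for i
    using that by (simp add: eq_unary_iff)
  define ws where "ws = run (map (\<lambda>i. (2 * i + 1, 2 * i + 2)) [0..<h - 1]) zs"
  have parity: "2 * i + 1 \<noteq> 2 * i' + 2" for i i' :: nat by presburger
  have inj: "inj_on (\<lambda>i. 2 * i + 1) A" "inj_on (\<lambda>i. 2 * i + 2) A" for A :: "nat set"
    by (simp_all add: inj_on_def)
  have bounds: "2 * i + 1 < length zs \<and> 2 * i + 2 < length zs" if "i < h - 1" for i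
    using that \<open>length zs = 2 * h\<close> by linarith
  have par: "ws ! (2 * i + 1) = max (zs ! (2 * i + 1)) (zs ! (2 * i + 2))"
      "ws ! (2 * i + 2) = min (zs ! (2 * i + 1)) (zs ! (2 * i + 2))" if "i < h - 1" for i
    using run_parallel(1,2)[OF inj parity bounds that] by (simp_all only: ws_def)
  \<comment> \<open>The final bank skips only the two outermost wires.\<close>
  have unchanged: "ws ! j = zs ! j" if "j = 0 \<or> j = 2 * (h - 1) + 1" for j
    unfolding ws_def by (rule run_parallel(3)[OF inj parity bounds])
      (use that in \<open>auto simp: Suc_double_not_eq_double\<close>)
  have half: "i div 2 \<le> (i + 1) div 2" "(i + 1) div 2 \<le> i div 2 + 1" "(i + 1) div 2 + i div 2 = i"
    for i :: nat by presburger+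
  have ED: "D \<le> E" "E \<le> D + 2" "E + D = p + q"
    using half[of p] half[of q] unfolding D_def E_def by linarith+
  have "ws ! j \<longleftrightarrow> j < p + q" if "j < 2 * h" for j
  proof -
    consider "j = 0" | i where "i < h - 1" "j = 2 * i + 1" | i where "i < h - 1" "j = 2 * i + 2"
      | "j = 2 * (h - 1) + 1"
    proof (cases "even j")
      case True
      then obtain i where "j = 2 * i" by (rule evenE)
      with \<open>j < 2 * h\<close> show ?thesis using that(1) that(3)[of "i - 1"] by (cases i) auto
    next
      case False
      then obtain i where "j = 2 * i + 1" by (rule oddE)
      moreover from this \<open>j < 2 * h\<close> have "i < h - 1 \<or> i = h - 1" by linarith
      ultimately show ?thesis using that(2,4) by blast
    qed
    then show ?thesis
    proof cases
      case 1
      with unchanged[of j] zs_even[of 0] \<open>1 < h\<close> ED show ?thesis by auto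
    next
      case 2
      then have "ws ! j \<longleftrightarrow> zs ! (2 * i + 1) \<or> zs ! (2 * (i + 1))"
        using par(1)[of i] by (simp add: max_bool)
      also have "\<dots> \<longleftrightarrow> i < D \<or> i + 1 < E"
        using 2 zs_odd[of i] zs_even[of "i + 1"] by simp
      \<comment> \<open>By \<open>ED\<close>, \<open>E\<close> is \<open>D\<close>,
        \<open>D + 1\<close> or \<open>D + 2\<close>, and the equivalence holds in each
        case.\<close>
      also have "\<dots> \<longleftrightarrow> j < p + q" using 2 ED by arith
      finally show ?thesis .
    next
      case 3
      then have "ws ! j \<longleftrightarrow> zs ! (2 * i + 1) \<and> zs ! (2 * (i + 1))"
        using par(2)[of i] by (simp add: min_bool)
      also have "\<dots> \<longleftrightarrow> i < D \<and> i + 1 < E"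
        using 3 zs_odd[of i] zs_even[of "i + 1"] by simp
      also have "\<dots> \<longleftrightarrow> j < p + q" using 3 ED by arith
      finally show ?thesis .
    next
      case 4
      then have "ws ! j = zs ! j" by (intro unchanged) simp
      also have "\<dots> \<longleftrightarrow> h - 1 < D" using 4 zs_odd[of "h - 1"] \<open>1 < h\<close> by simp
      also have "\<dots> \<longleftrightarrow> j < p + q"
      proof
        assume "h - 1 < D"
        then show "j < p + q" using 4 ED \<open>1 < h\<close> by linarith
      next
        assume "j < p + q"
        \<comment> \<open>Here \<open>j\<close> is the last wire, so \<open>p + q\<close> must
          attain its maximum \<open>2 * h\<close>.\<close>
        then have "p = h" "q = h" using 4 pq \<open>1 < h\<close> by linarith+
        then have "D = h" using \<open>even h\<close> by (auto simp: D_def)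
        then show "h - 1 < D" using \<open>1 < h\<close> by simp
      qed
      finally show ?thesis .
    qed
  qed
  then have "ws = unary (p + q) (2 * h)" by (simp add: eq_unary_iff ws_def)
  moreover have "run (oe_merge (2 * h)) xs = ws"
    using \<open>1 < h\<close> by (simp add: oe_merge_double run_append ws_def zs_def ys_def)
  ultimately show ?case by (simp add: xs_def h_def)
qed

lemma run_oe_sort: "length xs = 2 ^ a \<Longrightarrow> run (oe_sort (2 ^ a)) xs = unary (ones xs) (2 ^ a)"
proof (induction a arbitrary: xs)
  case 0
  then show ?case by (cases xs) (auto simp: unary_def)
next
  case (Suc a)
  define ys where "ys = take (2 ^ a) xs"
  define zs where "zs = drop (2 ^ a) xs"
  have xs: "xs = ys @ zs" and len: "length ys = 2 ^ a" "length zs = 2 ^ a"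
    using Suc.prems by (simp_all add: ys_def zs_def)
  have "run (relocate (\<lambda>i. 2 ^ a + i) (oe_sort (2 ^ a))) (run (oe_sort (2 ^ a)) ys @ zs)
      = run (oe_sort (2 ^ a)) ys @ run (oe_sort (2 ^ a)) zs"
    using run_append_right[of "run (oe_sort (2 ^ a)) ys"] len by simp
  then have "run (oe_sort (2 ^ Suc a)) xs
      = run (oe_merge (2 ^ Suc a)) (unary (ones ys) (2 ^ a) @ unary (ones zs) (2 ^ a))"
    using len wires_oe_sort[of a]
    by (simp add: oe_sort_double run_append xs run_append_left Suc.IH)
  also have "\<dots> = unary (ones xs) (2 ^ Suc a)"
    using len count_le_length[of ys True] count_le_length[of zs True] by (subst run_oe_merge) (simp_all add: xs)
  finally show ?case .
qed

section \<open>The bitonic merger on Boolean inputs\<close>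

text \<open>
  Bitonic is meant cyclically: of the form \<open>1\<^sup>*0\<^sup>*1\<^sup>*\<close> (if \<open>c\<close>) or
  \<open>0\<^sup>*1\<^sup>*0\<^sup>*\<close> (if \<open>\<not> c\<close>), which is what \<^term>\<open>split\<close> preserves.
\<close>

definition bitonic :: "bool list \<Rightarrow> bool" where
  "bitonic xs \<longleftrightarrow> (\<exists>a b c. \<forall>i<length xs. xs ! i \<longleftrightarrow> (i < a \<or> b \<le> i) = c)"

lemma bitonicI: "(\<And>i. i < length xs \<Longrightarrow> xs ! i \<longleftrightarrow> (i < a \<or> b \<le> i) = c) \<Longrightarrow> bitonic xs"
  unfolding bitonic_def by blast

text \<open>Complementing flips \<open>c\<close>, which reduces one bitonic shape to the
  other.\<close>

lemma bitonic_map_Not: "bitonic (map Not xs) \<longleftrightarrow> bitonic xs"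
proof -
  have "bitonic (map Not xs)" if "bitonic xs" for xs
  proof -
    from that obtain a b c where "\<forall>i<length xs. xs ! i \<longleftrightarrow> (i < a \<or> b \<le> i) = c"
      by (auto simp: bitonic_def)
    then show ?thesis by (intro bitonicI[where a = a and b = b and c = "\<not> c"]) auto
  qed
  from this[of xs] this[of "map Not xs"] show ?thesis by (auto simp: comp_def)
qed

text \<open>The zeros form one interval from \<open>a\<close> up to, but excluding,
  \<open>b\<close>. Folding the two halves onto each other, the disjunction has zeros where both
  parts of the interval overlap, and the conjunction where at least one part lies. An interval of
  length at most \<open>h\<close> has no overlap; a longer one covers every position.\<close>

lemma bitonic_halves_aux:
  assumes len: "length xs = h" "length ys = h"
    and bit: "\<And>i. i < 2 * h \<Longrightarrow> (xs @ ys) ! i \<longleftrightarrow> i < a \<or> b \<le> i"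
  shows "bitonic (map2 (\<or>) xs ys) \<and> bitonic (map2 (\<and>) xs ys)
    \<and> (map2 (\<or>) xs ys = unary h h \<or> map2 (\<and>) xs ys = unary 0 h)"
proof -
  have x: "xs ! i \<longleftrightarrow> i < a \<or> b \<le> i" if "i < h" for i
    using bit[of i] that len by (simp add: nth_append)
  have y: "ys ! i \<longleftrightarrow> i + h < a \<or> b \<le> i + h" if "i < h" for i
    using bit[of "i + h"] that len by (simp add: nth_append)
  have disj: "bitonic (map2 (\<or>) xs ys)"
    by (rule bitonicI[where a = a and b = "b - h" and c = True]) (use len in \<open>auto simp: x y\<close>)
  \<comment> \<open>The interval of zeros is empty, lies in the first half, lies in the second half,
    or meets the boundary between them.\<close>
  consider "b < a" | "a \<le> b" "b < h" | "a \<le> b" "h < a" | "a \<le> h" "h \<le> b" by linarith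
  then have "bitonic (map2 (\<and>) xs ys)"
  proof cases
    case 1
    then show ?thesis
      by (intro bitonicI[where a = 0 and b = 0 and c = True]) (use len in \<open>auto simp: x y\<close>)
  next
    case 2
    then show ?thesis
      by (intro bitonicI[where a = a and b = b and c = True]) (use len in \<open>auto simp: x y\<close>)
  next
    case 3
    then show ?thesis
      by (intro bitonicI[where a = "a - h" and b = "b - h" and c = True]) (use len in \<open>auto simp: x y\<close>)
  next
    case 4
    \<comment> \<open>The zeros of the conjunction now sit at both ends, leaving the ones from
      \<open>b - h\<close> up to \<open>a\<close>: the shape changes to
      \<open>c = False\<close>.\<close>
    then show ?thesis
      by (intro bitonicI[where a = "b - h" and b = a and c = False]) (use len in \<open>auto simp: x y\<close>)
  qed
  moreover have "map2 (\<or>) xs ys = unary h h \<or> map2 (\<and>) xs ys = unary 0 h"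
  proof (cases "b - h \<le> a \<or> b < h \<or> h < a")
    case True
    then have "map2 (\<or>) xs ys = unary h h"
      using len by (auto simp: eq_unary_iff x y)
    then show ?thesis ..
  next
    case False
    then have "map2 (\<and>) xs ys = unary 0 h"
      using len by (auto simp: eq_unary_iff x y)
    then show ?thesis ..
  qed
  ultimately show ?thesis using disj by blast
qed

text \<open>For \<open>c = False\<close>, pass to complements: De Morgan exchanges disjunction with
  conjunction and all ones with all zeros, so the claim is self-dual.\<close>

lemma bitonic_halves:
  assumes len: "length xs = h" "length ys = h" and "bitonic (xs @ ys)"
  shows "bitonic (map2 (\<or>) xs ys) \<and> bitonic (map2 (\<and>) xs ys)
    \<and> (map2 (\<or>) xs ys = unary h h \<or> map2 (\<and>) xs ys = unary 0 h)"
proof -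
  obtain a b c where abc: "\<And>i. i < 2 * h \<Longrightarrow> (xs @ ys) ! i \<longleftrightarrow> (i < a \<or> b \<le> i) = c"
    using assms by (auto simp: bitonic_def)
  show ?thesis
  proof (cases c)
    case True
    then show ?thesis using abc bitonic_halves_aux[OF len] by simp
  next
    case False
    let ?xs = "map Not xs" and ?ys = "map Not ys"
    have "(?xs @ ?ys) ! i \<longleftrightarrow> i < a \<or> b \<le> i" if "i < 2 * h" for i
      using abc[OF that] False that len by (simp flip: map_append)
    note dual = bitonic_halves_aux[OF _ _ this, simplified len length_map, OF refl refl]
    have "map2 (\<or>) ?xs ?ys = map Not (map2 (\<and>) xs ys)" "map2 (\<and>) ?xs ?ys = map Not (map2 (\<or>) xs ys)"
      using len by (auto intro!: nth_equalityI)
    with dual show ?thesis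
      unfolding bitonic_map_Not using len by (auto simp: bitonic_map_Not eq_unary_iff simp del: map_map)
  qed
qed

text \<open>Splitting only permutes entries, so it preserves the total number of ones.\<close>

lemma ones_disj_conj:
  "length xs = length ys \<Longrightarrow> ones (map2 (\<or>) xs ys) + ones (map2 (\<and>) xs ys) = ones xs + ones ys"
  by (induction rule: list_induct2) auto

section \<open>Recursion and correctness of the bitonic merger\<close>

lemma bit_merge_1 [simp]: "bit_merge (Suc 0) = []"
  by (simp add: bit_merge.simps)

text \<open>Unlike the definition, this equation needs no exception for two wires.\<close>

lemma bit_merge_double:
  assumes "0 < h"
  shows "bit_merge (2 * h) = split (2 * h) @ bit_merge h @ relocate (\<lambda>i. h + i) (bit_merge h)"
proof (cases "h = 1")
  case True
  have "bit_merge 2 = [(0, 1)]" by (simp add: bit_merge.simps)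
  with True show ?thesis by (simp add: split_def relocate_def)
qed (use assms in \<open>subst bit_merge.simps, simp\<close>)

lemma wires_bit_merge: "wires (bit_merge (2 ^ a)) (2 ^ a)"
proof (induction a)
  case (Suc a)
  have "wires (split (2 * 2 ^ a)) (2 * 2 ^ a)" by (auto simp: split_def wires_def)
  with Suc show ?case by (auto simp: bit_merge_double intro: wires_mono wires_relocate)
qed simp

text \<open>After the split both halves are bitonic, and the left is all ones or the right all
  zeros. Sorting them separately therefore sorts the whole, by \<open>unary_append\<close>.\<close>

lemma run_bit_merge:
  "length xs = 2 ^ a \<Longrightarrow> bitonic xs \<Longrightarrow> run (bit_merge (2 ^ a)) xs = unary (ones xs) (2 ^ a)"
proof (induction a arbitrary: xs)
  case 0
  then show ?case by (cases xs) (auto simp: unary_def)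
next
  case (Suc a)
  define h :: nat where "h = 2 ^ a"
  define ys where "ys = take h xs"
  define zs where "zs = drop h xs"
  have xs: "xs = ys @ zs" and len: "length ys = h" "length zs = h"
    using Suc.prems by (simp_all add: ys_def zs_def h_def)
  let ?L = "map2 (\<or>) ys zs" and ?R = "map2 (\<and>) ys zs"
  have halves: "bitonic ?L" "bitonic ?R" "?L = unary h h \<or> ?R = unary 0 h"
    using bitonic_halves[OF len] Suc.prems(2) xs by simp_all
  have len': "length ?L = h" "length ?R = h" using len by simp_all
  have "run (bit_merge h) ?L = unary (ones ?L) h" "run (bit_merge h) ?R = unary (ones ?R) h"
    using Suc.IH halves len' by (simp_all only: h_def)
  moreover have "run (bit_merge (2 * h)) xs = run (bit_merge h) ?L @ run (bit_merge h) ?R"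
    using run_append_right[of "run (bit_merge h) ?L" "bit_merge h" ?R] len' wires_bit_merge[of a] len
    by (simp add: bit_merge_double run_append xs run_split max_bool min_bool run_append_left flip: h_def)
      (simp add: h_def bit_merge_double run_append xs run_split max_bool min_bool run_append_left)
  moreover have "ones ?L = h \<or> ones ?R = 0" "ones ?L \<le> h"
    using halves(3) count_le_length[of ?L True] len' by (auto simp: min_def)
  ultimately show ?case
    using ones_disj_conj[of ys zs] len xs by (simp add: unary_append h_def mult_2)
qed

section \<open>Selection\<close>

definition select_pair :: "nat \<Rightarrow> 'a::linorder list \<Rightarrow> 'a list \<Rightarrow> 'a list" where
  "select_pair k B B' = run (bit_merge k) (left (run (bit_split (2 * k)) (B @ B')))"

lemma bit_sel_round_eq:
  "bit_sel_round k Bs = map (\<lambda>i. select_pair k (Bs ! (2 * i)) (Bs ! (2 * i + 1))) [0..<length Bs div 2]"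
  by (simp add: bit_sel_round_def select_pair_def)

lemma select_pair_eq:
  "length B = k \<Longrightarrow> length B' = k \<Longrightarrow> select_pair k B B' = run (bit_merge k) (map2 max B (rev B'))"
  by (simp add: select_pair_def left_run_bit_split)

lemma length_select_pair: "length B = k \<Longrightarrow> length B' = k \<Longrightarrow> length (select_pair k B B') = k"
  by (simp add: select_pair_eq)

lemma select_pair_map:
  assumes "mono f" and "k = 2 ^ b" and "length B = k" and "length B' = k"
  shows "select_pair k (map f B) (map f B') = map f (select_pair k B B')"
proof -
  have "map2 max (map f B) (rev (map f B')) = map f (map2 max B (rev B'))"
    using assms by (auto intro!: nth_equalityI simp: rev_nth max_of_mono)
  moreover have "wires (bit_merge k) (length (map2 max B (rev B')))"
    using assms wires_bit_merge by simp
  ultimately show ?thesis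
    using assms by (simp only: select_pair_eq length_map run_map)
qed

text \<open>Reversing the second block puts its \<open>q\<close> ones at the far end, so the
  disjunction has \<open>p\<close> ones in front and \<open>q\<close> at the back. It is bitonic,
  and it is all ones as soon as the two runs meet.\<close>

lemma select_pair_unary:
  assumes "k = 2 ^ b" and "p \<le> k" and "q \<le> k"
  shows "select_pair k (unary p k) (unary q k) = unary (min k (p + q)) k"
proof -
  let ?xs = "map2 (\<or>) (unary p k) (rev (unary q k))"
  have nth: "?xs ! i \<longleftrightarrow> i < p \<or> k - q \<le> i" if "i < k" for i
    using that assms(3) by (auto simp: rev_nth)
  have "bitonic ?xs"
    by (rule bitonicI[where a = p and b = "k - q" and c = True]) (use nth in simp)
  then have "select_pair k (unary p k) (unary q k) = unary (ones ?xs) k"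
    unfolding select_pair_eq[OF length_unary length_unary] max_bool
    unfolding assms(1) by (rule run_bit_merge[rotated]) simp
  moreover have "ones ?xs = min k (p + q)"
  proof (cases "k \<le> p + q")
    case True
    then have "?xs = unary k k" by (auto simp: eq_unary_iff nth simp del: nth_map nth_zip)
    with True show ?thesis by simp
  next
    case False
    \<comment> \<open>Here \<open>p < k - q\<close>, so the two runs of ones are disjoint and their
      lengths add.\<close>
    then have "?xs = unary p (k - q) @ unary q q"
      by (intro nth_equalityI) (auto simp: nth_append nth simp del: nth_map nth_zip)
    with False show ?thesis by simp
  qed
  ultimately show ?thesis by simp
qed

section \<open>The selection loop: compatibility with monotone maps, and counting of ones\<close>

lemma bit_sel_loop_map:
  assumes "mono f" and "k = 2 ^ b" and "\<forall>B \<in> set Bs. length B = k"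
  shows "bit_sel_loop k (map (map f) Bs) = map (map f) (bit_sel_loop k Bs)"
  using assms(3)
proof (induction "length Bs" arbitrary: Bs rule: less_induct)
  case less
  have nth: "length (Bs ! i) = k" if "i < length Bs" for i
    using less.prems that by simp
  have round: "bit_sel_round k (map (map f) Bs) = map (map f) (bit_sel_round k Bs)"
    by (auto simp: bit_sel_round_eq nth select_pair_map[OF assms(1,2)])
  show ?case
  proof (cases "1 < length Bs")
    case True
    have "\<forall>B \<in> set (bit_sel_round k Bs). length B = k"
      by (auto simp: bit_sel_round_eq nth length_select_pair)
    with True less.hyps[of "bit_sel_round k Bs"] show ?thesis
      by (subst (1 2) bit_sel_loop.simps) (simp add: round, simp add: bit_sel_round_def)
  qed (subst (1 2) bit_sel_loop.simps, simp)
qed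

text \<open>If some \<open>f i\<close> exceeds \<open>k\<close>, both sides equal \<open>k\<close>;
  otherwise the inner truncation changes nothing.\<close>

lemma min_sum_min: "min k (\<Sum>i<n. min k (f i)) = min k (\<Sum>i<n. f i)" for n k :: nat
  by (induction n) auto

lemma sum_pairs: "(\<Sum>i<n. f (2 * i) + f (2 * i + 1)) = (\<Sum>i<2 * n. f i)" for f :: "nat \<Rightarrow> nat"
  by (induction n) auto

text \<open>Each round halves the number of blocks and adds the counts of ones in pairs, truncated
  at \<open>k\<close>. The bound \<open>p \<le> k\<close> makes \<open>p\<close> the actual count of
  ones in its block.\<close>

lemma bit_sel_loop_unary:
  assumes "k = 2 ^ b"
  shows "length Bs = 2 ^ c \<Longrightarrow> \<forall>B \<in> set Bs. \<exists>p\<le>k. B = unary p k \<Longrightarrow>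
    hd (bit_sel_loop k Bs) = unary (min k (\<Sum>i<length Bs. ones (Bs ! i))) k"
proof (induction c arbitrary: Bs)
  case 0
  then obtain B where "Bs = [B]" by (auto simp: length_Suc_conv)
  with 0 show ?case by (subst bit_sel_loop.simps) auto
next
  case (Suc c)
  let ?p = "\<lambda>i. ones (Bs ! i)"
  have p: "?p i \<le> k" "Bs ! i = unary (?p i) k" if i: "i < 2 * 2 ^ c" for i
  proof -
    have "Bs ! i \<in> set Bs" using Suc.prems(1) i by simp
    with Suc.prems(2) obtain p where "p \<le> k" "Bs ! i = unary p k" by blast
    then show "?p i \<le> k" "Bs ! i = unary (?p i) k" by simp_all
  qed
  define Cs where "Cs = bit_sel_round k Bs"
  have len: "length Cs = 2 ^ c" using Suc.prems(1) by (simp add: Cs_def bit_sel_round_def)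
  have Cs: "Cs ! i = unary (min k (?p (2 * i) + ?p (2 * i + 1))) k" if i: "i < 2 ^ c" for i
  proof -
    have "Cs ! i = select_pair k (Bs ! (2 * i)) (Bs ! (2 * i + 1))"
      using i Suc.prems(1) by (simp add: Cs_def bit_sel_round_eq)
    also have "\<dots> = select_pair k (unary (?p (2 * i)) k) (unary (?p (2 * i + 1)) k)"
      using i p(2)[of "2 * i"] p(2)[of "2 * i + 1"] by simp
    also have "\<dots> = unary (min k (?p (2 * i) + ?p (2 * i + 1))) k"
      using i p(1)[of "2 * i"] p(1)[of "2 * i + 1"] by (intro select_pair_unary[OF assms]) simp_all
    finally show ?thesis .
  qed
  have "\<forall>B \<in> set Cs. \<exists>p\<le>k. B = unary p k"
    unfolding set_conv_nth using Cs len by (auto intro: min.cobounded1)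
  with Suc.IH[OF len] have "hd (bit_sel_loop k Cs) = unary (min k (\<Sum>i<2 ^ c. ones (Cs ! i))) k"
    by (simp add: len)
  also have "(\<Sum>i<2 ^ c. ones (Cs ! i)) = (\<Sum>i<2 ^ c. min k (?p (2 * i) + ?p (2 * i + 1)))"
    by (rule sum.cong) (simp_all add: Cs)
  also have "min k \<dots> = min k (\<Sum>i<2 * 2 ^ c. ?p i)"
    unfolding min_sum_min sum_pairs[of ?p] ..
  finally have "hd (bit_sel_loop k Cs) = unary (min k (\<Sum>i<2 * 2 ^ c. ?p i)) k" .
  moreover have "1 < length Bs"
    unfolding Suc.prems(1) by (rule one_less_power) simp_all
  ultimately show ?case
    using Suc.prems(1) by (subst bit_sel_loop.simps) (simp add: Cs_def)
qed

section \<open>Partition into blocks, and the whole selection network on Boolean inputs\<close>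

lemma blocks_Suc: "blocks (Suc l) k xs = take k xs # blocks l k (drop k xs)"
  unfolding blocks_def upt_conv_Cons[OF zero_less_Suc]
  by (simp add: map_Suc_upt[symmetric] comp_def add.commute del: upt_Suc)

lemma concat_blocks: "length xs = l * k \<Longrightarrow> concat (blocks l k xs) = xs"
  by (induction l arbitrary: xs) (simp_all add: blocks_Suc, simp add: blocks_def)

lemma length_blocks: "length xs = l * k \<Longrightarrow> B \<in> set (blocks l k xs) \<Longrightarrow> length B = k"
proof (induction l arbitrary: xs)
  case (Suc l)
  from Suc.IH[of "drop k xs"] Suc.prems show ?case by (auto simp: blocks_Suc)
qed (simp add: blocks_def)

lemma blocks_map: "blocks l k (map f xs) = map (map f) (blocks l k xs)"
  by (simp add: blocks_def take_map drop_map)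

lemma sum_ones_concat: "(\<Sum>i<length Bs. ones (Bs ! i)) = ones (concat Bs)"
  by (induction Bs) (simp_all add: lessThan_Suc_eq_insert_0 sum.reindex)

lemma bit_sel_bool:
  assumes k: "k = 2 ^ b" and l: "n div k = 2 ^ c" and len: "length xs = n div k * k"
  shows "bit_sel n k xs = unary (min k (ones xs)) k"
proof -
  let ?Bs = "blocks (n div k) k xs"
  have sort: "run (oe_sort k) B = unary (ones B) k" "ones B \<le> k" if "B \<in> set ?Bs" for B
    using run_oe_sort[of B b] length_blocks[OF len that] k count_le_length[of B True] by auto
  have "bit_sel n k xs = unary (min k (\<Sum>i<length ?Bs. ones (map (run (oe_sort k)) ?Bs ! i))) k"
    unfolding bit_sel_def using sort l
    by (subst bit_sel_loop_unary[OF k, of _ c]) (auto simp: blocks_def)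
  also have "(\<Sum>i<length ?Bs. ones (map (run (oe_sort k)) ?Bs ! i)) = (\<Sum>i<length ?Bs. ones (?Bs ! i))"
    by (rule sum.cong) (simp_all add: sort)
  also have "\<dots> = ones xs"
    by (simp add: sum_ones_concat concat_blocks[OF len])
  finally show ?thesis .
qed

text \<open>Needed because \<open>hd\<close> commutes with \<open>map\<close> only on nonempty
  lists. A round is entered with at least two blocks, so it leaves at least one.\<close>

lemma bit_sel_loop_neq_Nil: "Bs \<noteq> [] \<Longrightarrow> bit_sel_loop k Bs \<noteq> []"
proof (induction k Bs rule: bit_sel_loop.induct)
  case (1 k Bs)
  then show ?case by (subst bit_sel_loop.simps) (auto simp: bit_sel_round_def)
qed

lemma bit_sel_map:
  assumes "mono f" and k: "k = 2 ^ b" and "0 < n div k" and len: "length xs = n div k * k"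
  shows "bit_sel n k (map f xs) = map f (bit_sel n k xs)"
proof -
  let ?Bs = "map (run (oe_sort k)) (blocks (n div k) k xs)"
  have "map (run (oe_sort k)) (blocks (n div k) k (map f xs)) = map (map f) ?Bs"
    using length_blocks[OF len] wires_oe_sort[of b] k by (simp add: blocks_map run_map[OF assms(1)])
  moreover have "bit_sel_loop k (map (map f) ?Bs) = map (map f) (bit_sel_loop k ?Bs)"
    using length_blocks[OF len] by (intro bit_sel_loop_map[OF assms(1) k]) auto
  moreover have "?Bs \<noteq> []" using assms(3) by (simp add: blocks_def)
  ultimately show ?thesis
    by (simp only: bit_sel_def hd_map bit_sel_loop_neq_Nil not_False_eq_True)
qed

section \<open>From Boolean thresholds back to the original order\<close>

lemma sorted_desc_bool: "sorted_wrt (\<ge>) xs \<Longrightarrow> xs = unary (ones xs) (length xs)"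
proof (induction xs)
  case (Cons x xs)
  show ?case
  proof (cases x)
    case True
    with Cons show ?thesis by (auto simp: eq_unary_iff nth_Cons split: nat.split)
  next
    case False
    with Cons.prems have "True \<notin> set xs" by auto
    then have "ones xs = 0" "\<forall>i<length xs. \<not> xs ! i" by (auto simp: count_list_0_iff in_set_conv_nth)
    with False show ?thesis by (auto simp: eq_unary_iff nth_Cons split: nat.split)
  qed
qed (simp add: unary_def)

text \<open>A threshold turns a nonincreasing list into a nonincreasing Boolean list, which is
  determined by its count of ones; sorting does not affect that count.\<close>

lemma map_threshold_sort:
  "map ((\<le>) t) (take k (rev (sort xs))) = take k (unary (ones (map ((\<le>) t) xs)) (length xs))"
proof -
  let ?ys = "map ((\<le>) t) (rev (sort xs))"
  have "sorted_wrt (\<ge>) (rev (sort xs))" by (simp add: sorted_wrt_rev)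
  then have "sorted_wrt (\<ge>) ?ys"
    unfolding sorted_wrt_map by (rule sorted_wrt_mono_rel[rotated]) (auto intro: order_trans)
  then have "?ys = unary (ones ?ys) (length ?ys)" by (rule sorted_desc_bool)
  moreover have "ones ?ys = ones (map ((\<le>) t) xs)"
    by (simp flip: count_mset)
  ultimately show ?thesis by (simp flip: take_map)
qed

text \<open>An element is determined by the thresholds below it: using each of the two entries as
  threshold gives both inequalities.\<close>

lemma list_eq_thresholdI:
  fixes xs ys :: "'a::linorder list"
  assumes "\<And>t. map ((\<le>) t) xs = map ((\<le>) t) ys"
  shows "xs = ys"
proof (rule nth_equalityI)
  show len: "length xs = length ys" using assms by (rule map_eq_imp_length_eq)
  fix i assume i: "i < length xs"
  have "t \<le> xs ! i \<longleftrightarrow> t \<le> ys ! i" for t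
    using arg_cong[OF assms[of t], of "\<lambda>zs. zs ! i"] i len by simp
  then show "xs ! i = ys ! i" by (meson order.eq_iff)
qed

theorem theorem1:
  fixes n k :: nat and xs :: "nat list"
  assumes "\<exists>a. n = 2 ^ a" and "\<exists>b. k = 2 ^ b"
    and "1 \<le> k" and "k \<le> n"
    and "length xs = n"
  shows "sorted_wrt (\<ge>) (bit_sel n k xs) \<and> bit_sel n k xs = take k (rev (sort xs))"
proof -
  obtain a b where n: "n = 2 ^ a" and k: "k = 2 ^ b" using assms by blast
  with \<open>k \<le> n\<close> have "b \<le> a" by simp
  \<comment> \<open>Since \<open>b \<le> a\<close>, \<open>k\<close> divides \<open>n\<close>, so
    the blocks cover the input exactly.\<close>
  then have l: "n div k = 2 ^ (a - b)" and len: "length xs = n div k * k"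
    using assms(5) by (simp_all add: n k power_diff le_imp_power_dvd)
  have "bit_sel n k xs = take k (rev (sort xs))"
  proof (rule list_eq_thresholdI)
    fix t :: nat
    have "mono ((\<le>) t)" by (auto intro: monoI)
    then have "map ((\<le>) t) (bit_sel n k xs) = bit_sel n k (map ((\<le>) t) xs)"
      using l by (intro bit_sel_map[OF _ k _ len, symmetric]) simp_all
    also have "\<dots> = unary (min k (ones (map ((\<le>) t) xs))) k"
      using bit_sel_bool[OF k l] len by simp
    \<comment> \<open>Because \<open>k \<le> n\<close>, cutting the sorted threshold image to length
      \<open>k\<close> also truncates its count of ones at \<open>k\<close>.\<close>
    also have "\<dots> = map ((\<le>) t) (take k (rev (sort xs)))"
      unfolding map_threshold_sort using assms(4,5) by (auto intro!: nth_equalityI)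
    finally show "map ((\<le>) t) (bit_sel n k xs) = map ((\<le>) t) (take k (rev (sort xs)))" .
  qed
  moreover have "sorted_wrt (\<ge>) (take k (rev (sort xs)))"
    by (simp add: sorted_wrt_rev sorted_wrt_take)
  ultimately show ?thesis by simp
qed

end
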